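(* Let $n_1<n_2$ be positive integers, $\mathbf n=(n_1,n_2)$, and let the preferences of the $n_1$ men and $n_2$ women be independent and uniformly random. Let $\mathcal M:[n_1]\to[n_2]$ be a fixed (generic) injection. Let $P(\mathbf n)$ be the probability that $\mathcal M$ is stable; $P_k(\mathbf n)$ the probability that $\mathcal M$ is stable and $Q(\mathcal M)=k$; $P_\ell(\mathbf n)$ the probability that $\mathcal M$ is stable and $R(\mathcal M)=\ell$; and $P_{k,\ell}(\mathbf n)$ the probability that $\mathcal M$ is stable, $Q(\mathcal M)=k$ and $R(\mathcal M)=\ell$. Then, with $\bar x_i=1-x_i$, $\bar y_j=1-y_j$ and $i,j,h$ ranging over $[n_1]$, \begin{align*} P(\mathbf n)&=\int_{\mathbf x,\mathbf y\in[0,1]^{n_1}}\ \prod_{i\neq j}(1-x_iy_j)\prod_h\bar x_h^{\,n_2-n_1}\,d\mathbf x\,d\mathbf y,\\ P_k(\mathbf n)&=\int_{\mathbf x,\mathbf y\in[0,1]^{n_1}}\ [\xi^{k-n_1}]\prod_{i\neq j}\bigl(1-x_i(1-\xi+\xi y_j)\bigr)\prod_h\bar x_h^{\,n_2-n_1}\,d\mathbf x\,d\mathbf y,\\ P_\ell(\mathbf n)&=\int_{\mathbf x,\mathbf y\in[0,1]^{n_1}}\ [\eta^{\ell-n_1}]\prod_{i\neq j}\bigl(1-y_j(1-\eta+\eta x_i)\bigr)\prod_h\bar x_h^{\,n_2-n_1}\,d\mathbf x\,d\mathbf y,\\ P_{k,\ell}(\mathbf n)&=\int_{\mathbf x,\mathbf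 y\in[0,1]^{n_1}}\ [\xi^{k-n_1}\eta^{\ell-n_1}]\prod_{i\neq j}\bigl(\bar x_i\bar y_j+x_i\bar y_j\,\xi+\bar x_iy_j\,\eta\bigr)\prod_h\bar x_h^{\,n_2-n_1}\,d\mathbf x\,d\mathbf y. \end{align*}
   Context: There are $n_1$ men (the set $[n_1]$) and $n_2$ women (the set $[n_2]$), $n_1<n_2$. Each man strictly ranks all $n_2$ women and each woman strictly ranks all $n_1$ men; the $n_1+n_2$ rankings are independent, each a uniformly random permutation. A matching is an injection $\mathcal M:[n_1]\to[n_2]$. It is stable if there is no pair $(m,w)$, $m\in[n_1]$, $w\in[n_2]$, not matched to each other in $\mathcal M$, such that $m$ prefers $w$ to his partner $\mathcal M(m)$ and, if $w$ is matched in $\mathcal M$, $w$ prefers $m$ to her partner in $\mathcal M$ (an unmatched $w$ imposes no further condition). $Q(\mathcal M)$ is the total rank of wives: the sum over men $m$ of the position (1 = best) of $\mathcal M(m)$ in $m$'s list. $R(\mathcal M)$ is the total rank of husbands: the sum over matched women of the position (1 = best) of her husband in her list. By symmetry the probabilities do not depend on the choice of the injection $\mathcal M$. $P_k$ and $P_\ell$ denote two different families of probabilities, distinguished by the index letter ($k$ for $Q$, $\ell$ for $R$). $[\xi^a]F$ (respectively $[\xi^a\eta^b]F$) denotes the coefficient of $\xi^a$ (respectively $\xi^a\eta^b$) in the polynomial $F$, and $[n]=\{1,\dots,n\}$. The product $\prod_{i\ne j}$ is over ordered pairs $(i,j)\in[n_1]^2$ with $i\neq j$. *)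

theory Defs
  imports "HOL-Probability.Probability" "HOL-Computational_Algebra.Polynomial"
begin

text \<open>
  A ranking of \<open>{1..n}\<close> is encoded by its position function: a permutation \<open>p\<close> of \<open>{1..n}\<close>
  with \<open>p a\<close> the position of \<open>a\<close> in the list, position 1 being the best.
  A preference profile is a pair \<open>(mp, wp)\<close>: \<open>mp m w\<close> is the position of woman \<open>w\<close> in the
  list of man \<open>m\<close>, and \<open>wp w m\<close> is the position of man \<open>m\<close> in the list of woman \<open>w\<close>.
\<close>

type_synonym profile = "(nat \<Rightarrow> nat \<Rightarrow> nat) \<times> (nat \<Rightarrow> nat \<Rightarrow> nat)"

definition random_ranking :: "nat \<Rightarrow> (nat \<Rightarrow> nat) pmf" where
  "random_ranking n = pmf_of_set {p. p permutes {1..n}}"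

definition random_profile :: "nat \<Rightarrow> nat \<Rightarrow> profile pmf" where
  "random_profile n1 n2 =
     pair_pmf (Pi_pmf {1..n1} undefined (\<lambda>_. random_ranking n2))
              (Pi_pmf {1..n2} undefined (\<lambda>_. random_ranking n1))"

definition matching :: "nat \<Rightarrow> nat \<Rightarrow> (nat \<Rightarrow> nat) \<Rightarrow> bool" where
  "matching n1 n2 \<M> \<longleftrightarrow> inj_on \<M> {1..n1} \<and> \<M> ` {1..n1} \<subseteq> {1..n2}"

definition husband :: "nat \<Rightarrow> (nat \<Rightarrow> nat) \<Rightarrow> nat \<Rightarrow> nat" where
  "husband n1 \<M> w = inv_into {1..n1} \<M> w"

definition blocking :: "nat \<Rightarrow> profile \<Rightarrow> (nat \<Rightarrow> nat) \<Rightarrow> nat \<Rightarrow> nat \<Rightarrow> bool" where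
  "blocking n1 prf \<M> m w \<longleftrightarrow>
     \<M> m \<noteq> w \<and> fst prf m w < fst prf m (\<M> m) \<and>
     (w \<in> \<M> ` {1..n1} \<longrightarrow> snd prf w m < snd prf w (husband n1 \<M> w))"

definition stable :: "nat \<Rightarrow> nat \<Rightarrow> profile \<Rightarrow> (nat \<Rightarrow> nat) \<Rightarrow> bool" where
  "stable n1 n2 prf \<M> \<longleftrightarrow> \<not> (\<exists>m\<in>{1..n1}. \<exists>w\<in>{1..n2}. blocking n1 prf \<M> m w)"

definition rank_wives :: "nat \<Rightarrow> profile \<Rightarrow> (nat \<Rightarrow> nat) \<Rightarrow> nat" where
  "rank_wives n1 prf \<M> = (\<Sum>m\<in>{1..n1}. fst prf m (\<M> m))"

definition rank_husbands :: "nat \<Rightarrow> profile \<Rightarrow> (nat \<Rightarrow> nat) \<Rightarrow> nat" where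
  "rank_husbands n1 prf \<M> = (\<Sum>w\<in>\<M> ` {1..n1}. snd prf w (husband n1 \<M> w))"

definition prob_stable :: "nat \<Rightarrow> nat \<Rightarrow> (nat \<Rightarrow> nat) \<Rightarrow> real" where
  "prob_stable n1 n2 \<M> =
     measure_pmf.prob (random_profile n1 n2) {prf. stable n1 n2 prf \<M>}"

definition prob_stable_Q :: "nat \<Rightarrow> nat \<Rightarrow> (nat \<Rightarrow> nat) \<Rightarrow> nat \<Rightarrow> real" where
  "prob_stable_Q n1 n2 \<M> k =
     measure_pmf.prob (random_profile n1 n2)
       {prf. stable n1 n2 prf \<M> \<and> rank_wives n1 prf \<M> = k}"

definition prob_stable_R :: "nat \<Rightarrow> nat \<Rightarrow> (nat \<Rightarrow> nat) \<Rightarrow> nat \<Rightarrow> real" where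
  "prob_stable_R n1 n2 \<M> l =
     measure_pmf.prob (random_profile n1 n2)
       {prf. stable n1 n2 prf \<M> \<and> rank_husbands n1 prf \<M> = l}"

definition prob_stable_QR :: "nat \<Rightarrow> nat \<Rightarrow> (nat \<Rightarrow> nat) \<Rightarrow> nat \<Rightarrow> nat \<Rightarrow> real" where
  "prob_stable_QR n1 n2 \<M> k l =
     measure_pmf.prob (random_profile n1 n2)
       {prf. stable n1 n2 prf \<M> \<and> rank_wives n1 prf \<M> = k \<and> rank_husbands n1 prf \<M> = l}"

text \<open>
  Coefficient extraction with integer exponents, a coefficient at a negative exponent being 0.
  (With natural numbers, \<open>k - n1\<close> would be truncated to 0 for \<open>k < n1\<close>.)
\<close>

definition icoeff :: "'a::zero poly \<Rightarrow> int \<Rightarrow> 'a" where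
  "icoeff F a = (if a < 0 then 0 else coeff F (nat a))"

text \<open>
  Polynomials in \<open>\<xi>\<close> and \<open>\<eta>\<close> are polynomials in \<open>\<xi>\<close> whose coefficients are polynomials in \<open>\<eta>\<close>.
\<close>

definition icoeff2 :: "'a::zero poly poly \<Rightarrow> int \<Rightarrow> int \<Rightarrow> 'a" where
  "icoeff2 F a b = icoeff (icoeff F a) b"

abbreviation indet :: "real poly" where "indet \<equiv> [:0, 1:]"
abbreviation const2 :: "real \<Rightarrow> real poly poly" where "const2 c \<equiv> [:[:c:]:]"
abbreviation xi2 :: "real poly poly" where "xi2 \<equiv> [:0, 1:]"
abbreviation eta2 :: "real poly poly" where "eta2 \<equiv> [:[:0, 1:]:]"

definition off_diag :: "nat \<Rightarrow> (nat \<times> nat) set" where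
  "off_diag n = {(i, j). i \<in> {1..n} \<and> j \<in> {1..n} \<and> i \<noteq> j}"

definition unit_cube :: "nat \<Rightarrow> (nat \<Rightarrow> real) set" where
  "unit_cube n = (\<Pi>\<^sub>E i\<in>{1..n}. {0..1})"

definition lborel_pow :: "nat \<Rightarrow> (nat \<Rightarrow> real) measure" where
  "lborel_pow n = Pi\<^sub>M {1..n} (\<lambda>_. lborel)"

definition cube_integral :: "nat \<Rightarrow> ((nat \<Rightarrow> real) \<Rightarrow> (nat \<Rightarrow> real) \<Rightarrow> real) \<Rightarrow> real" where
  "cube_integral n f =
     set_lebesgue_integral (lborel_pow n \<Otimes>\<^sub>M lborel_pow n)
       (unit_cube n \<times> unit_cube n) (\<lambda>(x, y). f x y)"

end

theory Submission
  imports Defs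
begin

text \<open>
  Record which pairs \<open>(i, j)\<close>, \<open>i \<noteq> j\<close>, have man \<open>i\<close> preferring \<open>\<M> j\<close> to his partner (the set \<open>A\<close>),
  and which have \<open>\<M> j\<close> preferring \<open>i\<close> to \<open>j\<close> (the set \<open>B\<close>). The matching is stable iff \<open>A\<close> and \<open>B\<close>
  are disjoint and no man prefers an unmatched woman to his partner; then the total ranks are
  \<open>n1 + |A|\<close> and \<open>n1 + |B|\<close>. In a uniformly random ranking of \<open>n\<close> items a given set of \<open>c\<close> items is
  exactly the set ranked above a given item with probability
  \<open>c! (n-1-c)! / n! = \<integral>\<^sub>0\<^sup>1 t\<^sup>c (1-t)\<^sup>n\<^sup>-\<^sup>1\<^sup>-\<^sup>c dt\<close>, so each pair \<open>(A, B)\<close> has as its probability the cube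
  integral of a product over the off-diagonal pairs. Summing over the disjoint pairs \<open>(A, B)\<close>, each
  off-diagonal \<open>(i, j)\<close> lying in \<open>A\<close>, in \<open>B\<close> or in neither, is the expansion of the products of
  three-term sums in the theorem.
\<close>

section \<open>Items ranked above a given item\<close>

text \<open>The set itself is kept, not only its size, because whether a pair blocks depends on
  which items lie above \<open>a\<close>.\<close>

definition preferred :: "nat \<Rightarrow> (nat \<Rightarrow> nat) \<Rightarrow> nat \<Rightarrow> nat set" where
  "preferred n p a = {b \<in> {1..n}. p b < p a}"

lemma preferred_subset: "preferred n p a \<subseteq> {1..n} - {a}"
  by (auto simp: preferred_def)

text \<open>The permutation maps the items above \<open>a\<close> bijectively onto the positions
  from 1 to \<open>p a - 1\<close>.\<close>

lemma position_eq_card_preferred: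
  assumes p: "p permutes {1..n}" and a: "a \<in> {1..n}"
  shows "p a = card (preferred n p a) + 1"
proof -
  have "p ` preferred n p a = {1..<p a}"
  proof
    show "p ` preferred n p a \<subseteq> {1..<p a}"
      using permutes_in_image[OF p] by (force simp: preferred_def)
    show "{1..<p a} \<subseteq> p ` preferred n p a"
    proof
      fix v assume v: "v \<in> {1..<p a}"
      have "p a \<in> {1..n}" using a permutes_in_image[OF p] by blast
      then have "v \<in> p ` {1..n}" using v permutes_image[OF p] by simp
      then show "v \<in> p ` preferred n p a" using v by (auto simp: preferred_def)
    qed
  qed
  then have "card (preferred n p a) = p a - 1"
    using card_image[OF inj_on_subset[OF permutes_inj[OF p] subset_UNIV]]
    by (metis card_atLeastLessThan)
  \<comment> \<open>Positions start at 1, so the subtraction \<open>p a - 1\<close> is not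
    truncated.\<close>
  moreover have "p a \<in> {1..n}" using a permutes_in_image[OF p] by blast
  ultimately show ?thesis by simp
qed

text \<open>Following a permutation by the transposition of \<open>a\<close> and \<open>v\<close>
  exchanges the permutations that fix \<open>a\<close> with those that send \<open>a\<close> to
  \<open>v\<close>.\<close>

lemma card_permutes_value:
  assumes "finite U" "a \<in> U" "v \<in> U"
  shows "card {p. p permutes U \<and> p a = v} = fact (card U - 1)"
proof -
  have "bij_betw (\<lambda>p. Transposition.transpose a v \<circ> p) {p. p permutes U - {a}} {p. p permutes U \<and> p a = v}"
  proof (rule bij_betw_byWitness[where f' = "\<lambda>p. Transposition.transpose a v \<circ> p"])
    show "(\<lambda>p. Transposition.transpose a v \<circ> p) ` {p. p permutes U - {a}} \<subseteq> {p. p permutes U \<and> p a = v}"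
      using assms
      by (auto intro!: permutes_compose permutes_swap_id intro: permutes_subset simp: permutes_not_in)
    show "(\<lambda>p. Transposition.transpose a v \<circ> p) ` {p. p permutes U \<and> p a = v} \<subseteq> {p. p permutes U - {a}}"
    proof clarify
      fix p assume p: "p permutes U" and v: "v = p a"
      then have "Transposition.transpose a (p a) \<circ> p permutes U"
        using assms by (intro permutes_compose permutes_swap_id) auto
      then show "Transposition.transpose a (p a) \<circ> p permutes U - {a}"
        by (rule permutes_superset) (use v in auto)
    qed
  qed (auto simp: fun_eq_iff)
  then have "card {p. p permutes U \<and> p a = v} = card {p. p permutes U - {a}}"
    by (simp add: bij_betw_same_card)
  also have "\<dots> = fact (card U - 1)"
    using assms by (subst card_permutations[OF refl]) auto
  finally show ?thesis .
qed

text \<open>The complements of \<open>S\<close> and \<open>S'\<close> in \<open>U\<close> also have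
  equal size, so a bijection between the sets and one between the complements glue together to a
  permutation of \<open>U\<close>.\<close>

lemma ex_permutes_image:
  assumes "finite U" "S \<subseteq> U" "S' \<subseteq> U" "card S = card S'"
  obtains f where "f permutes U" "f ` S = S'"
proof -
  have "finite S" "finite S'" using assms finite_subset by auto
  with assms obtain g h where g: "bij_betw g S S'" and h: "bij_betw h (U - S) (U - S')"
    using finite_same_card_bij[of S S'] finite_same_card_bij[of "U - S" "U - S'"]
    by (auto simp: card_Diff_subset)
  define f where "f x = (if x \<in> S then g x else if x \<in> U then h x else x)" for x
  have f: "bij_betw f S S'" "bij_betw f (U - S) (U - S')"
    using g h bij_betw_cong[of S f g S'] bij_betw_cong[of "U - S" f h "U - S'"]
    by (auto simp: f_def)
  have "bij_betw f (S \<union> (U - S)) (S' \<union> (U - S'))"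
    by (intro bij_betw_combine f) auto
  then have "bij_betw f U U" using assms by (simp add: Un_absorb1)
  then have "f permutes U"
    by (rule bij_imp_permutes) (use assms in \<open>auto simp: f_def\<close>)
  moreover have "f ` S = S'" using f(1) by (simp add: bij_betw_def)
  ultimately show ?thesis by (rule that)
qed

text \<open>Relabelling the items by a permutation that fixes \<open>a\<close> and carries
  \<open>S\<close> to \<open>S'\<close> turns the rankings of one kind into those of the other.
  Hence all sets of one size are equally likely to be the set above \<open>a\<close>.\<close>

lemma card_preferred_eq_transfer:
  assumes "S \<subseteq> {1..n} - {a}" "S' \<subseteq> {1..n} - {a}" "card S = card S'"
  shows "card {p. p permutes {1..n} \<and> preferred n p a = S}
         = card {p. p permutes {1..n} \<and> preferred n p a = S'}"
proof -
  obtain f where f: "f permutes {1..n} - {a}" "f ` S = S'"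
    using ex_permutes_image[of "{1..n} - {a}" S S'] assms by auto
  have f1: "f permutes {1..n}" using f(1) by (rule permutes_subset) auto
  have fa: "f a = a" using f(1) by (simp add: permutes_not_in)
  note i1 = permutes_inv[OF f1]
  have ia: "inv f a = a" using fa f1 by (metis permutes_inverses(2))
  have im: "inv f ` S' = S" using f permutes_inj[OF f1] by (auto simp: image_image)
  \<comment> \<open>In \<open>p \<circ> g\<close> the item \<open>b\<close> has the position that
    \<open>p\<close> gives to \<open>g b\<close>. As \<open>g\<close> fixes \<open>a\<close>, the
    set above \<open>a\<close> is pulled back along \<open>g\<close>.\<close>
  have pre: "preferred n (p \<circ> g) a = inv g ` preferred n p a"
    if "g permutes {1..n}" "g a = a" for p g :: "nat \<Rightarrow> nat"
  proof -
    have "preferred n (p \<circ> g) a = g -` preferred n p a"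
      using that permutes_in_image[OF that(1)] by (auto simp: preferred_def vimage_def simp del: atLeastAtMost_iff)
    then show ?thesis using bij_vimage_eq_inv_image[OF permutes_bij[OF that(1)]] by simp
  qed
  have "bij_betw (\<lambda>p. p \<circ> inv f) {p. p permutes {1..n} \<and> preferred n p a = S}
          {p. p permutes {1..n} \<and> preferred n p a = S'}"
  proof (rule bij_betw_byWitness[where f' = "\<lambda>p. p \<circ> f"])
    show "\<forall>p\<in>{p. p permutes {1..n} \<and> preferred n p a = S}. p \<circ> inv f \<circ> f = p"
      by (simp add: comp_assoc permutes_inv_o[OF f1])
    show "\<forall>p\<in>{p. p permutes {1..n} \<and> preferred n p a = S'}. p \<circ> f \<circ> inv f = p"
      by (simp add: comp_assoc permutes_inv_o[OF f1])
    show "(\<lambda>p. p \<circ> inv f) ` {p. p permutes {1..n} \<and> preferred n p a = S}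
        \<subseteq> {p. p permutes {1..n} \<and> preferred n p a = S'}"
      using i1 pre[OF i1 ia] f(2) by (auto intro: permutes_compose simp: permutes_inv_inv[OF f1])
    show "(\<lambda>p. p \<circ> f) ` {p. p permutes {1..n} \<and> preferred n p a = S'}
        \<subseteq> {p. p permutes {1..n} \<and> preferred n p a = S}"
      using f1 pre[OF f1 fa] im by (auto intro: permutes_compose)
  qed
  then show ?thesis by (rule bij_betw_same_card)
qed

text \<open>With \<open>c = card S\<close>, there are \<open>fact (n - 1)\<close> rankings that put
  \<open>a\<close> at position \<open>c + 1\<close>. They split evenly among the
  \<open>(n - 1) choose c\<close> possible sets of size \<open>c\<close> above \<open>a\<close>,
  which leaves \<open>fact c * fact (n - 1 - c)\<close> rankings for each set.\<close>

lemma prob_preferred_eq: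
  assumes a: "a \<in> {1..n}" and S: "S \<subseteq> {1..n} - {a}"
  shows "measure_pmf.prob (random_ranking n) {p. preferred n p a = S}
         = fact (card S) * fact (n - 1 - card S) / fact n"
proof -
  let ?N = "\<lambda>S. card {p. p permutes {1..n} \<and> preferred n p a = S}"
  let ?F = "{S'. S' \<subseteq> {1..n} - {a} \<and> card S' = card S}"
  have le: "card S \<le> n - 1" "card S + 1 \<le> n" using card_mono[OF _ S] a by auto
  have fin: "finite {p. p permutes {1..n}}" by (rule finite_permutations) simp
  have "{p. p permutes {1..n} \<and> p a = card S + 1}
      = (\<Union>S'\<in>?F. {p. p permutes {1..n} \<and> preferred n p a = S'})"
  proof (intro set_eqI iffI)
    fix p assume "p \<in> {p. p permutes {1..n} \<and> p a = card S + 1}"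
    then show "p \<in> (\<Union>S'\<in>?F. {p. p permutes {1..n} \<and> preferred n p a = S'})"
      using preferred_subset[of n p a] position_eq_card_preferred[OF _ a, of p]
      by (intro UN_I[of "preferred n p a"]) (blast | simp)+
  next
    fix p assume "p \<in> (\<Union>S'\<in>?F. {p. p permutes {1..n} \<and> preferred n p a = S'})"
    then show "p \<in> {p. p permutes {1..n} \<and> p a = card S + 1}"
      using position_eq_card_preferred[OF _ a, of p] by auto
  qed
  then have "fact (n - 1) = card (\<Union>S'\<in>?F. {p. p permutes {1..n} \<and> preferred n p a = S'})"
    using card_permutes_value[of "{1..n}" a "card S + 1"] a le by simp
  also have "\<dots> = (\<Sum>S'\<in>?F. ?N S')"
    by (rule card_UN_disjoint) (auto intro: finite_subset[OF _ fin])
  also have "\<dots> = (\<Sum>S'\<in>?F. ?N S)"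
    by (intro sum.cong refl card_preferred_eq_transfer) (use S in auto)
  also have "\<dots> = ((n - 1) choose card S) * ?N S"
    using n_subsets[of "{1..n} - {a}" "card S"] a by simp
  finally have "real ((n - 1) choose card S) * real (?N S) = fact (n - 1)"
    by (metis of_nat_fact of_nat_mult)
  then have N: "real (?N S) = fact (card S) * fact (n - 1 - card S)"
    using le by (simp add: binomial_fact field_simps)
  have ne: "{p. p permutes {1..n}} \<noteq> {}" using permutes_id by blast
  have "measure_pmf.prob (random_ranking n) {p. preferred n p a = S} = real (?N S) / fact n"
    unfolding random_ranking_def using measure_pmf_of_set[OF ne fin]
    by (simp add: card_permutations[OF refl] Int_def)
  then show ?thesis by (simp only: N)
qed

section \<open>Integrals over the cube\<close>

text \<open>This is the Beta function at \<open>a + 1\<close> and \<open>b + 1\<close>, with the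
  Gamma values at positive integers written as factorials.\<close>

lemma set_integral_power_times_power:
  fixes a b :: nat
  shows "set_integrable lborel {0..1::real} (\<lambda>t. t ^ a * (1 - t) ^ b)"
    and "set_lebesgue_integral lborel {0..1::real} (\<lambda>t. t ^ a * (1 - t) ^ b)
         = fact a * fact b / fact (a + b + 1)"
proof -
  show i: "set_integrable lborel {0..1::real} (\<lambda>t. t ^ a * (1 - t) ^ b)"
    by (intro borel_integrable_atLeastAtMost' continuous_intros)
  have "((\<lambda>t::real. t powr (real (Suc a) - 1) * (1 - t) powr (real (Suc b) - 1))
      has_integral Beta (real (Suc a)) (real (Suc b))) {0..1}"
    by (rule has_integral_Beta_real) auto
  then have "((\<lambda>t::real. t ^ a * (1 - t) ^ b)
      has_integral Beta (real (Suc a)) (real (Suc b))) {0..1}"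
    \<comment> \<open>The integrands with \<open>powr\<close> and with natural powers can differ
      only at 0 and 1: \<open>0 powr 0\<close> is 0, while \<open>0 ^ 0\<close> is 1.\<close>
    by (rule has_integral_spike_finite[of "{0,1}", rotated 2]) (auto simp: powr_realpow)
  moreover have "Beta (real (Suc a)) (real (Suc b)) = fact a * fact b / fact (a + b + 1)"
    using Gamma_fact[of "a + b + 1", where 'a = real]
    by (simp add: Beta_def Gamma_fact add_ac)
  ultimately show "set_lebesgue_integral lborel {0..1::real} (\<lambda>t. t ^ a * (1 - t) ^ b)
         = fact a * fact b / fact (a + b + 1)"
    using set_borel_integral_eq_integral(2)[OF i] by (simp add: integral_unique)
qed

lemma (in pair_sigma_finite) integral_product_mult:
  fixes f g :: "_ \<Rightarrow> real"
  assumes f: "integrable M1 f" and g: "integrable M2 g"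
  shows "integrable (M1 \<Otimes>\<^sub>M M2) (\<lambda>(x, y). f x * g y)"
    and "(\<integral>(x, y). f x * g y \<partial>(M1 \<Otimes>\<^sub>M M2)) = (\<integral>x. f x \<partial>M1) * (\<integral>y. g y \<partial>M2)"
proof -
  have [measurable]: "f \<in> borel_measurable M1" "g \<in> borel_measurable M2"
    using f g by auto
  show i: "integrable (M1 \<Otimes>\<^sub>M M2) (\<lambda>(x, y). f x * g y)"
    by (rule Fubini_integrable) (use f g in \<open>auto simp: abs_mult\<close>)
  show "(\<integral>(x, y). f x * g y \<partial>(M1 \<Otimes>\<^sub>M M2)) = (\<integral>x. f x \<partial>M1) * (\<integral>y. g y \<partial>M2)"
    using integral_fst'[OF i] by simp
qed

text \<open>Kept beside \<open>cube_integral\<close> because the integral of a non-integrable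
  function is 0 by convention, so exchanging it with finite sums requires integrability of each
  summand.\<close>

definition cube_integrable :: "nat \<Rightarrow> ((nat \<Rightarrow> real) \<Rightarrow> (nat \<Rightarrow> real) \<Rightarrow> real) \<Rightarrow> bool" where
  "cube_integrable n f \<longleftrightarrow>
     set_integrable (lborel_pow n \<Otimes>\<^sub>M lborel_pow n) (unit_cube n \<times> unit_cube n) (\<lambda>(x, y). f x y)"

lemma cube_integral_sum:
  assumes "\<And>a. a \<in> S \<Longrightarrow> cube_integrable n (f a)"
  shows "cube_integral n (\<lambda>x y. \<Sum>a\<in>S. f a x y) = (\<Sum>a\<in>S. cube_integral n (f a))"
  using assms Bochner_Integration.integral_sum
    [of S "lborel_pow n \<Otimes>\<^sub>M lborel_pow n" "\<lambda>a z. indicator (unit_cube n \<times> unit_cube n) z *\<^sub>R (case z of (x, y) \<Rightarrow> f a x y)"]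
  by (simp add: cube_integral_def cube_integrable_def set_lebesgue_integral_def
      set_integrable_def case_prod_beta' sum_distrib_left)

text \<open>Points of the product space are extensional, so membership in the cube is a condition on
  each coordinate separately.\<close>

lemma indicator_unit_cube:
  assumes "x \<in> space (lborel_pow n)"
  shows "indicator (unit_cube n) x = (\<Prod>i\<in>{1..n}. indicator {0..1} (x i) :: real)"
proof -
  have "x \<in> extensional {1..n}" using assms by (auto simp: lborel_pow_def space_PiM PiE_def)
  then show ?thesis
    by (auto simp: unit_cube_def PiE_def indicator_def Pi_def intro!: prod.neutral)
qed

text \<open>The indicator of the cube factors over the coordinates and can be absorbed into the
  factors of the integrand. Fubini then separates \<open>x\<close> from \<open>y\<close>, and the
  product measure separates the coordinates.\<close>

lemma cube_integral_prod:
  fixes f g :: "nat \<Rightarrow> real \<Rightarrow> real"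
  assumes f: "\<And>i. i \<in> {1..n} \<Longrightarrow> set_integrable lborel {0..1} (f i)"
    and g: "\<And>i. i \<in> {1..n} \<Longrightarrow> set_integrable lborel {0..1} (g i)"
  shows "cube_integrable n (\<lambda>x y. (\<Prod>i\<in>{1..n}. f i (x i)) * (\<Prod>i\<in>{1..n}. g i (y i)))"
    and "cube_integral n (\<lambda>x y. (\<Prod>i\<in>{1..n}. f i (x i)) * (\<Prod>i\<in>{1..n}. g i (y i)))
      = (\<Prod>i\<in>{1..n}. set_lebesgue_integral lborel {0..1} (f i))
        * (\<Prod>i\<in>{1..n}. set_lebesgue_integral lborel {0..1} (g i))"
proof -
  interpret product_sigma_finite "\<lambda>_::nat. lborel :: real measure" ..
  interpret L: sigma_finite_measure "lborel_pow n"
    unfolding lborel_pow_def by (rule sigma_finite) simp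
  interpret P: pair_sigma_finite "lborel_pow n" "lborel_pow n" ..
  let ?h = "\<lambda>f x. \<Prod>i\<in>{1..n}. indicator {0..1} (x i) * f i (x i) :: real"
  have h: "integrable (lborel_pow n) (?h u)" "(\<integral>x. ?h u x \<partial>lborel_pow n)
      = (\<Prod>i\<in>{1..n}. set_lebesgue_integral lborel {0..1} (u i))"
    if "\<And>i. i \<in> {1..n} \<Longrightarrow> set_integrable lborel {0..1} (u i)" for u :: "nat \<Rightarrow> real \<Rightarrow> real"
    using product_integrable_prod[of "{1..n}" "\<lambda>i t. indicator {0..1} t * u i t"]
      product_integral_prod[of "{1..n}" "\<lambda>i t. indicator {0..1} t * u i t"] that
    by (simp_all add: lborel_pow_def set_integrable_def set_lebesgue_integral_def)
  have eq: "indicator (unit_cube n \<times> unit_cube n) (x, y) *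
      ((\<Prod>i\<in>{1..n}. f i (x i)) * (\<Prod>i\<in>{1..n}. g i (y i))) = ?h f x * ?h g y"
    if "x \<in> space (lborel_pow n)" "y \<in> space (lborel_pow n)" for x y
    using that by (simp add: indicator_times indicator_unit_cube prod.distrib)
  let ?K = "\<lambda>z. indicator (unit_cube n \<times> unit_cube n) z *\<^sub>R
      (case z of (x, y) \<Rightarrow> (\<Prod>i\<in>{1..n}. f i (x i)) * (\<Prod>i\<in>{1..n}. g i (y i)))"
  have eq': "?K z = (case z of (x, y) \<Rightarrow> ?h f x * ?h g y)"
    if "z \<in> space (lborel_pow n \<Otimes>\<^sub>M lborel_pow n)" for z
    using that eq by (cases z) (simp add: space_pair_measure)
  show "cube_integrable n (\<lambda>x y. (\<Prod>i\<in>{1..n}. f i (x i)) * (\<Prod>i\<in>{1..n}. g i (y i)))"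
    unfolding cube_integrable_def set_integrable_def
    using P.integral_product_mult(1)[OF h(1)[OF f] h(1)[OF g]]
    by (subst Bochner_Integration.integrable_cong[OF refl eq'])
  show "cube_integral n (\<lambda>x y. (\<Prod>i\<in>{1..n}. f i (x i)) * (\<Prod>i\<in>{1..n}. g i (y i)))
      = (\<Prod>i\<in>{1..n}. set_lebesgue_integral lborel {0..1} (f i))
        * (\<Prod>i\<in>{1..n}. set_lebesgue_integral lborel {0..1} (g i))"
    unfolding cube_integral_def set_lebesgue_integral_def[of "_ \<Otimes>\<^sub>M _"]
    using P.integral_product_mult(2)[OF h(1)[OF f] h(1)[OF g]] h(2)[OF f] h(2)[OF g]
    by (subst Bochner_Integration.integral_cong[OF refl eq']) simp_all
qed

section \<open>Expansion over disjoint patterns\<close>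

text \<open>The two-term expansion is applied twice: \<open>A\<close> collects the positions where
  \<open>a\<close> is chosen, and \<open>B\<close> those among the rest where \<open>b\<close> is
  chosen.\<close>

lemma prod_add3:
  fixes a b c :: "'a \<Rightarrow> 'b::comm_semiring_1"
  assumes "finite F"
  shows "(\<Prod>p\<in>F. a p + b p + c p)
    = (\<Sum>(A, B)\<in>(SIGMA A:Pow F. Pow (F - A)). prod a A * prod b B * prod c (F - A - B))"
proof -
  have "(\<Prod>p\<in>F. a p + b p + c p) = (\<Prod>p\<in>F. a p + (b p + c p))"
    by (simp add: add.assoc)
  also have "\<dots> = (\<Sum>A\<in>Pow F. prod a A * (\<Prod>p\<in>F - A. b p + c p))"
    by (rule prod_add[OF assms])
  also have "\<dots> = (\<Sum>A\<in>Pow F. \<Sum>B\<in>Pow (F - A). prod a A * prod b B * prod c (F - A - B))"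
    by (intro sum.cong refl) (simp add: prod_add assms sum_distrib_left mult.assoc)
  also have "\<dots> = (\<Sum>(A, B)\<in>(SIGMA A:Pow F. Pow (F - A)). prod a A * prod b B * prod c (F - A - B))"
    by (rule sum.Sigma) (use assms in auto)
  finally show ?thesis .
qed

text \<open>The condition is written \<open>n + d s = k\<close> to avoid truncated subtraction. For
  \<open>k < n\<close> no \<open>s\<close> satisfies it, in agreement with the value 0 of a
  coefficient at a negative exponent.\<close>

lemma icoeff_sum_monom:
  assumes "finite S"
  shows "icoeff (\<Sum>s\<in>S. monom (f s) (d s)) (int k - int n) = (\<Sum>s\<in>{s \<in> S. n + d s = k}. f s)"
proof (cases "k < n")
  case True
  then have "{s \<in> S. n + d s = k} = {}" by auto
  then show ?thesis using True by (simp add: icoeff_def)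
next
  case False
  then have "nat (int k - int n) = k - n" by auto
  with False have "icoeff (\<Sum>s\<in>S. monom (f s) (d s)) (int k - int n)
      = (\<Sum>s\<in>S. if n + d s = k then f s else 0)"
    by (auto simp: icoeff_def coeff_sum intro!: sum.cong)
  also have "\<dots> = (\<Sum>s\<in>{s \<in> S. n + d s = k}. f s)"
    by (simp add: sum.inter_filter[OF assms])
  finally show ?thesis .
qed

lemma prod_if_power:
  fixes a b :: "'a::comm_monoid_mult"
  assumes "finite V" "C \<subseteq> V"
  shows "(\<Prod>j\<in>V. if j \<in> C then a else b) = a ^ card C * b ^ (card V - card C)"
proof -
  have "V \<inter> C = C" "V \<inter> - C = V - C" using assms by auto
  with assms show ?thesis
    by (simp add: prod.If_cases card_Diff_subset finite_subset)
qed

lemma finite_off_diag: "finite (off_diag n)"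
  by (rule finite_subset[of _ "{1..n} \<times> {1..n}"]) (auto simp: off_diag_def)

text \<open>Grouping by rows collects the factors in \<open>x i\<close>, and grouping by columns
  those in \<open>y j\<close>.\<close>

lemma prod_off_diag:
  "(\<Prod>(i, j)\<in>off_diag n. f i j) = (\<Prod>i\<in>{1..n}. \<Prod>j\<in>{1..n} - {i}. f i j)"
  "(\<Prod>(i, j)\<in>off_diag n. f i j) = (\<Prod>j\<in>{1..n}. \<Prod>i\<in>{1..n} - {j}. f i j)"
proof -
  have 1: "off_diag n = (SIGMA i:{1..n}. {1..n} - {i})" by (auto simp: off_diag_def)
  show "(\<Prod>(i, j)\<in>off_diag n. f i j) = (\<Prod>i\<in>{1..n}. \<Prod>j\<in>{1..n} - {i}. f i j)" for f
    unfolding 1 by (rule prod.Sigma[symmetric]) auto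
  from this[of "\<lambda>j i. f i j"]
  have "(\<Prod>(j, i)\<in>off_diag n. f i j) = (\<Prod>j\<in>{1..n}. \<Prod>i\<in>{1..n} - {j}. f i j)" .
  moreover have "(\<Prod>(j, i)\<in>off_diag n. f i j) = (\<Prod>(i, j)\<in>off_diag n. f i j)"
    by (rule prod.reindex_bij_witness[of _ prod.swap prod.swap]) (auto simp: off_diag_def)
  ultimately show "(\<Prod>(i, j)\<in>off_diag n. f i j) = (\<Prod>j\<in>{1..n}. \<Prod>i\<in>{1..n} - {j}. f i j)"
    by simp
qed

lemma card_eq_sum_Image:
  assumes "finite I" "finite A" "A \<subseteq> I \<times> UNIV"
  shows "card A = (\<Sum>i\<in>I. card (A `` {i}))"
proof -
  have "A = (SIGMA i:I. A `` {i})" using assms by auto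
  moreover have "card (SIGMA i:I. A `` {i}) = (\<Sum>i\<in>I. card (A `` {i}))"
    by (rule card_SigmaI) (use assms in auto)
  ultimately show ?thesis by simp
qed

section \<open>Pattern weights and the expansion of the four products\<close>

text \<open>For \<open>x\<close> and \<open>y\<close> in the cube this is the probability of the
  pattern \<open>(A, B)\<close> when each off-diagonal \<open>(i, j)\<close> enters \<open>A\<close>
  with probability \<open>x i\<close> and \<open>B\<close> with probability \<open>y j\<close>, all
  independently.\<close>

definition pattern_weight ::
    "nat \<Rightarrow> (nat \<Rightarrow> real) \<Rightarrow> (nat \<Rightarrow> real) \<Rightarrow> (nat \<times> nat) set \<Rightarrow> (nat \<times> nat) set \<Rightarrow> real" where
  "pattern_weight n x y A B =
     (\<Prod>(i, j)\<in>off_diag n. (if (i, j) \<in> A then x i else 1 - x i)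
                           * (if (i, j) \<in> B then y j else 1 - y j))"

definition disjoint_patterns :: "nat \<Rightarrow> ((nat \<times> nat) set \<times> (nat \<times> nat) set) set" where
  "disjoint_patterns n = (SIGMA A:Pow (off_diag n). Pow (off_diag n - A))"

lemma finite_disjoint_patterns: "finite (disjoint_patterns n)"
  by (auto simp: disjoint_patterns_def finite_off_diag)

text \<open>Disjointness rules out the factor \<open>x i * y j\<close>, so just three kinds of
  factor remain, one for each term of the expansion.\<close>

lemma pattern_weight_disjoint:
  assumes "(A, B) \<in> disjoint_patterns n"
  shows "pattern_weight n x y A B =
    (\<Prod>(i, j)\<in>A. x i * (1 - y j)) * (\<Prod>(i, j)\<in>B. (1 - x i) * y j)
    * (\<Prod>(i, j)\<in>off_diag n - A - B. (1 - x i) * (1 - y j))"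
proof -
  let ?w = "\<lambda>(i, j). (if (i, j) \<in> A then x i else 1 - x i) * (if (i, j) \<in> B then y j else 1 - y j)"
  have AB: "A \<subseteq> off_diag n" "B \<subseteq> off_diag n - A"
    using assms by (auto simp: disjoint_patterns_def)
  have "pattern_weight n x y A B = prod ?w A * prod ?w B * prod ?w (off_diag n - A - B)"
    unfolding pattern_weight_def
    using prod.subset_diff[OF AB(1) finite_off_diag, of ?w]
      prod.subset_diff[OF AB(2) finite_Diff[OF finite_off_diag], of ?w]
    by (simp add: mult_ac)
  also have "prod ?w A = (\<Prod>(i, j)\<in>A. x i * (1 - y j))"
    using AB by (intro prod.cong) auto
  also have "prod ?w B = (\<Prod>(i, j)\<in>B. (1 - x i) * y j)"
    using AB by (intro prod.cong) auto
  also have "prod ?w (off_diag n - A - B) = (\<Prod>(i, j)\<in>off_diag n - A - B. (1 - x i) * (1 - y j))"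
    by (intro prod.cong) auto
  finally show ?thesis .
qed

text \<open>The multiplicative map \<open>\<phi>\<close> stands for the embedding of the reals into
  the reals or into polynomials in one or two variables, so that one expansion serves all four
  products. The marker \<open>u\<close> counts the pairs in \<open>A\<close>, and \<open>v\<close>
  those in \<open>B\<close>.\<close>

lemma prod_eq_sum_patterns:
  fixes \<phi> :: "real \<Rightarrow> 'a::comm_semiring_1"
  assumes \<phi>: "\<phi> 1 = 1" "\<And>a b. \<phi> (a * b) = \<phi> a * \<phi> b"
  shows "(\<Prod>(i, j)\<in>off_diag n. \<phi> (x i * (1 - y j)) * u + \<phi> ((1 - x i) * y j) * v
            + \<phi> ((1 - x i) * (1 - y j)))
   = (\<Sum>(A, B)\<in>disjoint_patterns n. \<phi> (pattern_weight n x y A B) * (u ^ card A * v ^ card B))"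
proof -
  have prod: "\<phi> (prod f A) = (\<Prod>p\<in>A. \<phi> (f p))" for f and A :: "(nat \<times> nat) set"
    by (induction A rule: infinite_finite_induct) (simp_all add: \<phi>)
  have "(\<Prod>(i, j)\<in>off_diag n. \<phi> (x i * (1 - y j)) * u + \<phi> ((1 - x i) * y j) * v
            + \<phi> ((1 - x i) * (1 - y j)))
      = (\<Prod>p\<in>off_diag n. (\<lambda>p. \<phi> ((\<lambda>(i, j). x i * (1 - y j)) p) * u) p
          + (\<lambda>p. \<phi> ((\<lambda>(i, j). (1 - x i) * y j) p) * v) p
          + (\<lambda>p. \<phi> ((\<lambda>(i, j). (1 - x i) * (1 - y j)) p)) p)"
    by (intro prod.cong) auto
  also have "\<dots> = (\<Sum>(A, B)\<in>disjoint_patterns n.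
      \<phi> (pattern_weight n x y A B) * (u ^ card A * v ^ card B))"
    unfolding prod_add3[OF finite_off_diag] disjoint_patterns_def[symmetric]
    by (auto intro!: sum.cong
        simp: pattern_weight_disjoint \<phi>(2) prod[symmetric] prod.distrib mult_ac)
  finally show ?thesis .
qed

text \<open>With both markers equal to 1, the three terms add up to
  \<open>1 - x i * y j\<close>.\<close>

lemma prod_off_diag_eq_sum:
  fixes x y :: "nat \<Rightarrow> real"
  shows "(\<Prod>(i, j)\<in>off_diag n. 1 - x i * y j)
    = (\<Sum>(A, B)\<in>disjoint_patterns n. pattern_weight n x y A B)"
proof -
  have "(\<Prod>(i, j)\<in>off_diag n. 1 - x i * y j)
      = (\<Prod>(i, j)\<in>off_diag n. x i * (1 - y j) * 1 + (1 - x i) * y j * 1 + (1 - x i) * (1 - y j))"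
    by (intro prod.cong) (auto simp: algebra_simps)
  also have "\<dots> = (\<Sum>(A, B)\<in>disjoint_patterns n. pattern_weight n x y A B)"
    by (subst prod_eq_sum_patterns[of "\<lambda>t. t"]) simp_all
  finally show ?thesis .
qed

text \<open>Each factor equals \<open>x i * (1 - y j) * \<xi> + (1 - x i) * y j + (1 - x i) * (1 - y
  j)\<close>, so the exponent of \<open>\<xi>\<close> is \<open>card A\<close>.\<close>

lemma icoeff_prod_xi_eq_sum:
  fixes x y :: "nat \<Rightarrow> real"
  shows "icoeff (\<Prod>(i, j)\<in>off_diag n. 1 - [:x i:] * (1 - indet + indet * [:y j:])) (int k - int n)
    = (\<Sum>(A, B)\<in>{(A, B) \<in> disjoint_patterns n. n + card A = k}. pattern_weight n x y A B)"
proof -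
  have "(\<Prod>(i, j)\<in>off_diag n. 1 - [:x i:] * (1 - indet + indet * [:y j:]))
      = (\<Prod>(i, j)\<in>off_diag n. [:x i * (1 - y j):] * indet + [:(1 - x i) * y j:] * 1
          + [:(1 - x i) * (1 - y j):])"
    by (intro prod.cong) (auto simp: algebra_simps one_pCons)
  also have "\<dots> = (\<Sum>p\<in>disjoint_patterns n. monom (pattern_weight n x y (fst p) (snd p)) (card (fst p)))"
    by (subst prod_eq_sum_patterns[of "\<lambda>t. [:t:]"])
      (simp_all add: monom_altdef one_pCons[symmetric] case_prod_beta')
  finally show ?thesis
    by (simp add: icoeff_sum_monom finite_disjoint_patterns case_prod_beta')
qed

text \<open>Here the marker sits on the term \<open>(1 - x i) * y j\<close>, so the exponent of
  \<open>\<eta>\<close> is \<open>card B\<close>.\<close>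

lemma icoeff_prod_eta_eq_sum:
  fixes x y :: "nat \<Rightarrow> real"
  shows "icoeff (\<Prod>(i, j)\<in>off_diag n. 1 - [:y j:] * (1 - indet + indet * [:x i:])) (int l - int n)
    = (\<Sum>(A, B)\<in>{(A, B) \<in> disjoint_patterns n. n + card B = l}. pattern_weight n x y A B)"
proof -
  have "(\<Prod>(i, j)\<in>off_diag n. 1 - [:y j:] * (1 - indet + indet * [:x i:]))
      = (\<Prod>(i, j)\<in>off_diag n. [:x i * (1 - y j):] * 1 + [:(1 - x i) * y j:] * indet
          + [:(1 - x i) * (1 - y j):])"
    by (intro prod.cong) (auto simp: algebra_simps one_pCons)
  also have "\<dots> = (\<Sum>p\<in>disjoint_patterns n. monom (pattern_weight n x y (fst p) (snd p)) (card (snd p)))"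
    by (subst prod_eq_sum_patterns[of "\<lambda>t. [:t:]"])
      (simp_all add: monom_altdef one_pCons[symmetric] case_prod_beta')
  finally show ?thesis
    by (simp add: icoeff_sum_monom finite_disjoint_patterns case_prod_beta')
qed

lemma icoeff2_prod_eq_sum:
  fixes x y :: "nat \<Rightarrow> real"
  shows "icoeff2 (\<Prod>(i, j)\<in>off_diag n. const2 ((1 - x i) * (1 - y j))
           + const2 (x i * (1 - y j)) * xi2 + const2 ((1 - x i) * y j) * eta2)
         (int k - int n) (int l - int n)
    = (\<Sum>(A, B)\<in>{(A, B) \<in> disjoint_patterns n. n + card A = k \<and> n + card B = l}.
        pattern_weight n x y A B)"
proof -
  let ?W = "\<lambda>p. pattern_weight n x y (fst p) (snd p)"
  have eta2: "eta2 ^ b = [:indet ^ b:]" for b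
    by (simp add: poly_const_pow)
  \<comment> \<open>The outer variable carries \<open>card A\<close> and the inner one
    \<open>card B\<close>, so the two coefficients can be extracted one after the other.\<close>
  have mono: "const2 c * (xi2 ^ a * eta2 ^ b) = monom (monom c b) a" for c a b
    by (simp add: eta2 monom_altdef mult.commute)
  have "(\<Prod>(i, j)\<in>off_diag n. const2 ((1 - x i) * (1 - y j))
           + const2 (x i * (1 - y j)) * xi2 + const2 ((1 - x i) * y j) * eta2)
      = (\<Prod>(i, j)\<in>off_diag n. const2 (x i * (1 - y j)) * xi2 + const2 ((1 - x i) * y j) * eta2
          + const2 ((1 - x i) * (1 - y j)))"
    by (simp only: add_ac)
  also have "\<dots> = (\<Sum>p\<in>disjoint_patterns n. const2 (?W p) * (xi2 ^ card (fst p) * eta2 ^ card (snd p)))"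
    by (subst prod_eq_sum_patterns[of const2]) (simp_all add: one_pCons[symmetric] case_prod_beta')
  also have "\<dots> = (\<Sum>p\<in>disjoint_patterns n. monom (monom (?W p) (card (snd p))) (card (fst p)))"
    by (simp only: mono)
  finally show ?thesis
    by (simp add: icoeff2_def icoeff_sum_monom finite_disjoint_patterns case_prod_beta' conj_assoc)
qed

text \<open>Intersecting with the supports makes both sets countable without changing any
  probability, and the product rule for countable sets applies.\<close>

lemma prob_pair_pmf_Times:
  "measure_pmf.prob (pair_pmf M N) (A \<times> B) = measure_pmf.prob M A * measure_pmf.prob N B"
proof -
  have "measure_pmf.prob (pair_pmf M N) (A \<times> B)
      = measure_pmf.prob (pair_pmf M N) ((A \<inter> set_pmf M) \<times> (B \<inter> set_pmf N))"
    by (rule measure_prob_cong_0) (auto simp: pmf_pair set_pmf_iff)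
  also have "\<dots> = measure_pmf.prob M (A \<inter> set_pmf M) * measure_pmf.prob N (B \<inter> set_pmf N)"
    by (rule measure_pmf_prob_product) (auto intro: countable_subset[OF _ countable_set_pmf])
  finally show ?thesis by (simp add: measure_Int_set_pmf)
qed

section \<open>The cube integral of a single pattern\<close>

text \<open>Grouping by rows for \<open>A\<close> and by columns for \<open>B\<close> separates all
  variables, and each one-dimensional integral is a Beta integral. Row \<open>i\<close> of
  \<open>A\<close> gives the exponent of \<open>x i\<close>; column \<open>j\<close> of
  \<open>B\<close>, which is row \<open>j\<close> of the converse, gives that of
  \<open>y j\<close>.\<close>

lemma cube_integral_pattern_weight:
  assumes "n1 < n2" "A \<subseteq> off_diag n1" "B \<subseteq> off_diag n1"
  shows "cube_integrable n1
      (\<lambda>x y. pattern_weight n1 x y A B * (\<Prod>h\<in>{1..n1}. (1 - x h) ^ (n2 - n1)))"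
    and "cube_integral n1
      (\<lambda>x y. pattern_weight n1 x y A B * (\<Prod>h\<in>{1..n1}. (1 - x h) ^ (n2 - n1)))
    = (\<Prod>i\<in>{1..n1}. fact (card (A `` {i})) * fact (n2 - 1 - card (A `` {i})) / fact n2)
      * (\<Prod>j\<in>{1..n1}. fact (card (B\<inverse> `` {j})) * fact (n1 - 1 - card (B\<inverse> `` {j})) / fact n1)"
proof -
  have subA: "A `` {i} \<subseteq> {1..n1} - {i}" for i using assms(2) by (auto simp: off_diag_def)
  have subB: "B\<inverse> `` {i} \<subseteq> {1..n1} - {i}" for i using assms(3) by (auto simp: off_diag_def)
  have leA: "card (A `` {i}) \<le> n1 - 1" if "i \<in> {1..n1}" for i
    using card_mono[OF _ subA[of i]] that by simp
  have leB: "card (B\<inverse> `` {i}) \<le> n1 - 1" if "i \<in> {1..n1}" for i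
    using card_mono[OF _ subB[of i]] that by simp
  have eq: "pattern_weight n1 x y A B * (\<Prod>h\<in>{1..n1}. (1 - x h) ^ (n2 - n1))
    = (\<Prod>i\<in>{1..n1}. x i ^ card (A `` {i}) * (1 - x i) ^ (n2 - 1 - card (A `` {i})))
      * (\<Prod>j\<in>{1..n1}. y j ^ card (B\<inverse> `` {j}) * (1 - y j) ^ (n1 - 1 - card (B\<inverse> `` {j})))"
    for x y
  proof -
    have 1: "(\<Prod>j\<in>{1..n1} - {i}. if (i, j) \<in> A then x i else 1 - x i)
        = x i ^ card (A `` {i}) * (1 - x i) ^ (n1 - 1 - card (A `` {i}))"
      if "i \<in> {1..n1}" for i
      using prod_if_power[OF _ subA[of i], of "x i" "1 - x i"] that by simp
    have 2: "(\<Prod>i\<in>{1..n1} - {j}. if (i, j) \<in> B then y j else 1 - y j)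
        = y j ^ card (B\<inverse> `` {j}) * (1 - y j) ^ (n1 - 1 - card (B\<inverse> `` {j}))"
      if "j \<in> {1..n1}" for j
      using prod_if_power[OF _ subB[of j], of "y j" "1 - y j"] that by simp
    have "pattern_weight n1 x y A B
      = (\<Prod>(i, j)\<in>off_diag n1. if (i, j) \<in> A then x i else 1 - x i)
        * (\<Prod>(i, j)\<in>off_diag n1. if (i, j) \<in> B then y j else 1 - y j)"
      by (simp add: pattern_weight_def prod.distrib[symmetric] case_prod_beta')
    also have "(\<Prod>(i, j)\<in>off_diag n1. if (i, j) \<in> A then x i else 1 - x i)
        = (\<Prod>i\<in>{1..n1}. x i ^ card (A `` {i}) * (1 - x i) ^ (n1 - 1 - card (A `` {i})))"
      unfolding prod_off_diag(1) by (rule prod.cong[OF refl 1])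
    also have "(\<Prod>(i, j)\<in>off_diag n1. if (i, j) \<in> B then y j else 1 - y j)
        = (\<Prod>j\<in>{1..n1}. y j ^ card (B\<inverse> `` {j}) * (1 - y j) ^ (n1 - 1 - card (B\<inverse> `` {j})))"
      unfolding prod_off_diag(2) by (rule prod.cong[OF refl 2])
    finally have "pattern_weight n1 x y A B * (\<Prod>h\<in>{1..n1}. (1 - x h) ^ (n2 - n1))
      = (\<Prod>i\<in>{1..n1}. x i ^ card (A `` {i}) * (1 - x i) ^ (n1 - 1 - card (A `` {i}))
            * (1 - x i) ^ (n2 - n1))
        * (\<Prod>j\<in>{1..n1}. y j ^ card (B\<inverse> `` {j}) * (1 - y j) ^ (n1 - 1 - card (B\<inverse> `` {j})))"
      by (simp add: prod.distrib)
    also have "(\<Prod>i\<in>{1..n1}. x i ^ card (A `` {i}) * (1 - x i) ^ (n1 - 1 - card (A `` {i}))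
            * (1 - x i) ^ (n2 - n1))
        = (\<Prod>i\<in>{1..n1}. x i ^ card (A `` {i}) * (1 - x i) ^ (n2 - 1 - card (A `` {i})))"
    proof (rule prod.cong[OF refl])
      \<comment> \<open>The extra power \<open>n2 - n1\<close> accounts for the unmatched women, all
        of whom must rank below the partner of man \<open>i\<close>. It turns a count among
        \<open>n1\<close> women into one among \<open>n2\<close>.\<close>
      fix i assume i: "i \<in> {1..n1}"
      then have "n1 - 1 - card (A `` {i}) + (n2 - n1) = n2 - 1 - card (A `` {i})"
        using leA[OF i] assms(1) by auto
      then show "x i ^ card (A `` {i}) * (1 - x i) ^ (n1 - 1 - card (A `` {i})) * (1 - x i) ^ (n2 - n1)
          = x i ^ card (A `` {i}) * (1 - x i) ^ (n2 - 1 - card (A `` {i}))"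
        by (simp only: mult.assoc power_add[symmetric])
    qed
    finally show ?thesis .
  qed
  show "cube_integrable n1
      (\<lambda>x y. pattern_weight n1 x y A B * (\<Prod>h\<in>{1..n1}. (1 - x h) ^ (n2 - n1)))"
    unfolding eq by (rule cube_integral_prod(1)) (rule set_integral_power_times_power)+
  have "cube_integral n1
      (\<lambda>x y. pattern_weight n1 x y A B * (\<Prod>h\<in>{1..n1}. (1 - x h) ^ (n2 - n1)))
    = (\<Prod>i\<in>{1..n1}. fact (card (A `` {i})) * fact (n2 - 1 - card (A `` {i}))
          / fact (card (A `` {i}) + (n2 - 1 - card (A `` {i})) + 1))
      * (\<Prod>j\<in>{1..n1}. fact (card (B\<inverse> `` {j})) * fact (n1 - 1 - card (B\<inverse> `` {j}))
          / fact (card (B\<inverse> `` {j}) + (n1 - 1 - card (B\<inverse> `` {j})) + 1))"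
    unfolding eq by (subst cube_integral_prod(2)) (simp_all only: set_integral_power_times_power)
  also have "\<dots> = (\<Prod>i\<in>{1..n1}. fact (card (A `` {i})) * fact (n2 - 1 - card (A `` {i})) / fact n2)
      * (\<Prod>j\<in>{1..n1}. fact (card (B\<inverse> `` {j})) * fact (n1 - 1 - card (B\<inverse> `` {j})) / fact n1)"
  proof (rule arg_cong2[where f = "(*)"]; rule prod.cong[OF refl])
    fix i assume i: "i \<in> {1..n1}"
    then have "card (A `` {i}) + (n2 - 1 - card (A `` {i})) + 1 = n2"
      using leA[OF i] assms(1) by auto
    then show "fact (card (A `` {i})) * fact (n2 - 1 - card (A `` {i}))
          / fact (card (A `` {i}) + (n2 - 1 - card (A `` {i})) + 1)
        = (fact (card (A `` {i})) * fact (n2 - 1 - card (A `` {i})) / fact n2 :: real)" by simp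
  next
    fix i assume i: "i \<in> {1..n1}"
    then have "card (B\<inverse> `` {i}) + (n1 - 1 - card (B\<inverse> `` {i})) + 1 = n1"
      using leB[OF i] by auto
    then show "fact (card (B\<inverse> `` {i})) * fact (n1 - 1 - card (B\<inverse> `` {i}))
          / fact (card (B\<inverse> `` {i}) + (n1 - 1 - card (B\<inverse> `` {i})) + 1)
        = (fact (card (B\<inverse> `` {i})) * fact (n1 - 1 - card (B\<inverse> `` {i})) / fact n1 :: real)" by simp
  qed
  finally show "cube_integral n1
      (\<lambda>x y. pattern_weight n1 x y A B * (\<Prod>h\<in>{1..n1}. (1 - x h) ^ (n2 - n1)))
    = (\<Prod>i\<in>{1..n1}. fact (card (A `` {i})) * fact (n2 - 1 - card (A `` {i})) / fact n2)
      * (\<Prod>j\<in>{1..n1}. fact (card (B\<inverse> `` {j})) * fact (n1 - 1 - card (B\<inverse> `` {j})) / fact n1)" .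
qed

section \<open>Patterns of a random profile\<close>

text \<open>A matched woman is named by the index \<open>j\<close> of her husband, so that the
  pattern lives on the off-diagonal pairs. Unmatched women are left to
  \<open>prefers_no_single\<close>.\<close>

definition man_pattern :: "nat \<Rightarrow> (nat \<Rightarrow> nat) \<Rightarrow> profile \<Rightarrow> (nat \<times> nat) set" where
  "man_pattern n1 \<M> pf = {(i, j) \<in> off_diag n1. fst pf i (\<M> j) < fst pf i (\<M> i)}"

text \<open>The man comes first here too, so that a blocking pair shows up as a common element of
  the two patterns.\<close>

definition woman_pattern :: "nat \<Rightarrow> (nat \<Rightarrow> nat) \<Rightarrow> profile \<Rightarrow> (nat \<times> nat) set" where
  "woman_pattern n1 \<M> pf = {(i, j) \<in> off_diag n1. snd pf (\<M> j) i < snd pf (\<M> j) j}"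

definition prefers_no_single :: "nat \<Rightarrow> nat \<Rightarrow> (nat \<Rightarrow> nat) \<Rightarrow> profile \<Rightarrow> bool" where
  "prefers_no_single n1 n2 \<M> pf \<longleftrightarrow>
     (\<forall>i\<in>{1..n1}. preferred n2 (fst pf i) (\<M> i) \<subseteq> \<M> ` {1..n1})"

lemma husband_matching:
  assumes "matching n1 n2 \<M>" "j \<in> {1..n1}"
  shows "husband n1 \<M> (\<M> j) = j"
  using assms by (simp add: husband_def matching_def)

text \<open>An unmatched woman blocks with every man who prefers her to his partner. A matched woman
  \<open>\<M> j\<close> blocks with \<open>i\<close> precisely when \<open>(i, j)\<close> lies in
  both patterns.\<close>

lemma stable_iff_patterns:
  assumes M: "matching n1 n2 \<M>"
  shows "stable n1 n2 pf \<M> \<longleftrightarrow>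
    prefers_no_single n1 n2 \<M> pf \<and> man_pattern n1 \<M> pf \<inter> woman_pattern n1 \<M> pf = {}"
proof
  assume st: "stable n1 n2 pf \<M>"
  show "prefers_no_single n1 n2 \<M> pf \<and> man_pattern n1 \<M> pf \<inter> woman_pattern n1 \<M> pf = {}"
  proof
    show "prefers_no_single n1 n2 \<M> pf"
      using st by (force simp: prefers_no_single_def preferred_def stable_def blocking_def)
    show "man_pattern n1 \<M> pf \<inter> woman_pattern n1 \<M> pf = {}"
    proof (rule ccontr)
      assume "man_pattern n1 \<M> pf \<inter> woman_pattern n1 \<M> pf \<noteq> {}"
      then obtain i j where ij: "i \<in> {1..n1}" "j \<in> {1..n1}"
        "fst pf i (\<M> j) < fst pf i (\<M> i)" "snd pf (\<M> j) i < snd pf (\<M> j) j"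
        by (auto simp: man_pattern_def woman_pattern_def off_diag_def)
      then have "blocking n1 pf \<M> i (\<M> j)"
        using husband_matching[OF M ij(2)] by (auto simp: blocking_def)
      moreover have "\<M> j \<in> {1..n2}" using M ij(2) unfolding matching_def by blast
      ultimately show False using st ij(1) by (auto simp: stable_def)
    qed
  qed
next
  assume R: "prefers_no_single n1 n2 \<M> pf \<and> man_pattern n1 \<M> pf \<inter> woman_pattern n1 \<M> pf = {}"
  show "stable n1 n2 pf \<M>"
    unfolding stable_def
  proof clarify
    fix i w assume i: "i \<in> {1..n1}" and w: "w \<in> {1..n2}" and b: "blocking n1 pf \<M> i w"
    then have "w \<in> preferred n2 (fst pf i) (\<M> i)" by (auto simp: blocking_def preferred_def)
    with R i obtain j where j: "j \<in> {1..n1}" "w = \<M> j"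
      unfolding prefers_no_single_def by blast
    then have "(i, j) \<in> man_pattern n1 \<M> pf \<inter> woman_pattern n1 \<M> pf"
      using b i husband_matching[OF M j(1)]
      by (auto simp: blocking_def man_pattern_def woman_pattern_def off_diag_def)
    with R show False by blast
  qed
qed

lemma man_pattern_Image:
  assumes M: "matching n1 n2 \<M>" and i: "i \<in> {1..n1}"
  shows "\<M> ` (man_pattern n1 \<M> pf `` {i}) = preferred n2 (fst pf i) (\<M> i) \<inter> \<M> ` {1..n1}"
  using assms by (fastforce simp: man_pattern_def off_diag_def preferred_def matching_def)

text \<open>Every man is matched, so a column of the pattern captures the whole set above the
  husband, with no intersection as for the men.\<close>

lemma woman_pattern_Image:
  assumes "j \<in> {1..n1}"
  shows "(woman_pattern n1 \<M> pf)\<inverse> `` {j} = preferred n1 (snd pf (\<M> j)) j"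
  using assms by (auto simp: woman_pattern_def off_diag_def preferred_def)

lemma off_diag_eqI:
  assumes "C \<subseteq> off_diag n" "C' \<subseteq> off_diag n" "\<And>i. i \<in> {1..n} \<Longrightarrow> C `` {i} = C' `` {i}"
  shows "C = C'"
proof -
  have "(i, j) \<in> C \<longleftrightarrow> (i, j) \<in> C'" for i j
  proof (cases "i \<in> {1..n}")
    case True
    then show ?thesis using assms(3)[OF True] by blast
  next
    case False
    then show ?thesis using assms(1,2) unfolding off_diag_def by blast
  qed
  then show ?thesis by auto
qed

text \<open>Fixing both patterns constrains each person's ranking separately, so the event is a
  product set. The equation for man \<open>i\<close> also forces every woman above his partner to be
  matched; unmatched women are unconstrained.\<close>

lemma patterns_eq_Times:
  assumes M: "matching n1 n2 \<M>" and A: "A \<subseteq> off_diag n1" and B: "B \<subseteq> off_diag n1"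
  shows "{pf. prefers_no_single n1 n2 \<M> pf \<and> man_pattern n1 \<M> pf = A \<and> woman_pattern n1 \<M> pf = B}
    = Pi {1..n1} (\<lambda>i. {p. preferred n2 p (\<M> i) = \<M> ` (A `` {i})})
      \<times> Pi {1..n2} (\<lambda>w. if w \<in> \<M> ` {1..n1}
          then {p. preferred n1 p (husband n1 \<M> w) = B\<inverse> `` {husband n1 \<M> w}} else UNIV)"
    (is "?L = ?R")
proof (rule set_eqI)
  fix pf
  let ?A' = "man_pattern n1 \<M> pf" and ?B' = "woman_pattern n1 \<M> pf"
  have inj: "inj_on \<M> {1..n1}" and rng: "\<And>i. i \<in> {1..n1} \<Longrightarrow> \<M> i \<in> {1..n2}"
    using M unfolding matching_def by blast+
  have A': "?A' \<subseteq> off_diag n1" and B': "?B' \<subseteq> off_diag n1"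
    by (auto simp: man_pattern_def woman_pattern_def)
  have "pf \<in> ?R \<longleftrightarrow> (\<forall>i\<in>{1..n1}. preferred n2 (fst pf i) (\<M> i) = \<M> ` (A `` {i})) \<and>
      (\<forall>w\<in>\<M> ` {1..n1}. preferred n1 (snd pf w) (husband n1 \<M> w) = B\<inverse> `` {husband n1 \<M> w})"
    using rng by (cases pf) (auto simp: Pi_iff)
  also have "(\<forall>w\<in>\<M> ` {1..n1}. preferred n1 (snd pf w) (husband n1 \<M> w) = B\<inverse> `` {husband n1 \<M> w})
      \<longleftrightarrow> (\<forall>j\<in>{1..n1}. ?B'\<inverse> `` {j} = B\<inverse> `` {j})"
    by (simp add: husband_matching[OF M] woman_pattern_Image)
  also have "\<dots> \<longleftrightarrow> ?B' = B"
  proof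
    assume *: "\<forall>j\<in>{1..n1}. ?B'\<inverse> `` {j} = B\<inverse> `` {j}"
    \<comment> \<open>Columns are rows of the converse, so \<open>off_diag_eqI\<close> is applied to
      the converses.\<close>
    have "?B'\<inverse> = B\<inverse>"
      by (rule off_diag_eqI) (use * B B' in \<open>auto simp: off_diag_def\<close>)
    then show "?B' = B" by simp
  qed simp
  also have "(\<forall>i\<in>{1..n1}. preferred n2 (fst pf i) (\<M> i) = \<M> ` (A `` {i}))
      \<longleftrightarrow> prefers_no_single n1 n2 \<M> pf \<and> ?A' = A"
  proof
    assume *: "\<forall>i\<in>{1..n1}. preferred n2 (fst pf i) (\<M> i) = \<M> ` (A `` {i})"
    have sub: "A `` {i} \<subseteq> {1..n1}" "?A' `` {i} \<subseteq> {1..n1}" for i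
      using A A' by (auto simp: off_diag_def)
    have ns: "prefers_no_single n1 n2 \<M> pf"
      unfolding prefers_no_single_def using * sub(1) by blast
    have "?A' = A"
    proof (rule off_diag_eqI[OF A' A])
      fix i assume i: "i \<in> {1..n1}"
      then have "\<M> ` (?A' `` {i}) = \<M> ` (A `` {i})"
        using * ns man_pattern_Image[OF M i] by (simp add: prefers_no_single_def Int_absorb2)
      then show "?A' `` {i} = A `` {i}"
        using inj_on_image_eq_iff[OF inj sub(2) sub(1)] by blast
    qed
    with ns show "prefers_no_single n1 n2 \<M> pf \<and> ?A' = A" ..
  next
    assume "prefers_no_single n1 n2 \<M> pf \<and> ?A' = A"
    then show "\<forall>i\<in>{1..n1}. preferred n2 (fst pf i) (\<M> i) = \<M> ` (A `` {i})"
      using man_pattern_Image[OF M, of _ pf] by (simp add: prefers_no_single_def Int_absorb2)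
  qed
  finally show "pf \<in> ?L \<longleftrightarrow> pf \<in> ?R" by blast
qed

section \<open>The probability of a single pattern\<close>

text \<open>Independence turns the product set into a product of probabilities from
  \<open>prob_preferred_eq\<close>, with \<open>n2\<close> ranked items for each man and
  \<open>n1\<close> for each matched woman. The value is the one found for the cube integral of the
  pattern weight.\<close>

lemma prob_patterns:
  assumes M: "matching n1 n2 \<M>" and A: "A \<subseteq> off_diag n1" and B: "B \<subseteq> off_diag n1"
  shows "measure_pmf.prob (random_profile n1 n2)
      {pf. prefers_no_single n1 n2 \<M> pf \<and> man_pattern n1 \<M> pf = A \<and> woman_pattern n1 \<M> pf = B}
    = (\<Prod>i\<in>{1..n1}. fact (card (A `` {i})) * fact (n2 - 1 - card (A `` {i})) / fact n2)
      * (\<Prod>j\<in>{1..n1}. fact (card (B\<inverse> `` {j})) * fact (n1 - 1 - card (B\<inverse> `` {j})) / fact n1)"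
proof -
  have inj: "inj_on \<M> {1..n1}" and rng: "\<M> ` {1..n1} \<subseteq> {1..n2}"
    using M unfolding matching_def by blast+
  have subA: "A `` {i} \<subseteq> {1..n1} - {i}" for i using A by (auto simp: off_diag_def)
  have subB: "B\<inverse> `` {i} \<subseteq> {1..n1} - {i}" for i using B by (auto simp: off_diag_def)
  have man: "measure_pmf.prob (random_ranking n2) {p. preferred n2 p (\<M> i) = \<M> ` (A `` {i})}
      = fact (card (A `` {i})) * fact (n2 - 1 - card (A `` {i})) / fact n2"
    if i: "i \<in> {1..n1}" for i
  proof -
    have "\<M> ` (A `` {i}) \<subseteq> \<M> ` ({1..n1} - {i})" using subA by blast
    also have "\<dots> = \<M> ` {1..n1} - {\<M> i}"
      using i by (simp add: inj_on_image_set_diff[OF inj])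
    finally have "\<M> ` (A `` {i}) \<subseteq> {1..n2} - {\<M> i}" using rng by blast
    moreover have "card (\<M> ` (A `` {i})) = card (A `` {i})"
      by (rule card_image) (use inj_on_subset[OF inj] subA in blast)
    moreover have "\<M> i \<in> {1..n2}" using rng i by blast
    ultimately show ?thesis by (simp add: prob_preferred_eq)
  qed
  let ?g = "\<lambda>w. measure_pmf.prob (random_ranking n1) (if w \<in> \<M> ` {1..n1}
      then {p. preferred n1 p (husband n1 \<M> w) = B\<inverse> `` {husband n1 \<M> w}} else UNIV)"
  \<comment> \<open>An unmatched woman contributes the probability of \<open>UNIV\<close>, which is
    1.\<close>
  have "(\<Prod>w\<in>{1..n2}. ?g w) = (\<Prod>w\<in>\<M> ` {1..n1}. ?g w)"
    by (rule prod.mono_neutral_right) (use rng in auto)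
  also have "\<dots> = (\<Prod>j\<in>{1..n1}. ?g (\<M> j))"
    by (simp only: prod.reindex[OF inj] o_def)
  also have "\<dots> = (\<Prod>j\<in>{1..n1}. fact (card (B\<inverse> `` {j})) * fact (n1 - 1 - card (B\<inverse> `` {j})) / fact n1)"
  proof (rule prod.cong[OF refl])
    fix j assume j: "j \<in> {1..n1}"
    then show "?g (\<M> j) = fact (card (B\<inverse> `` {j})) * fact (n1 - 1 - card (B\<inverse> `` {j})) / fact n1"
      using prob_preferred_eq[OF j subB] by (simp add: husband_matching[OF M])
  qed
  finally have "(\<Prod>w\<in>{1..n2}. ?g w)
      = (\<Prod>j\<in>{1..n1}. fact (card (B\<inverse> `` {j})) * fact (n1 - 1 - card (B\<inverse> `` {j})) / fact n1)" .
  then show ?thesis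
    unfolding patterns_eq_Times[OF assms] random_profile_def
    by (simp add: prob_pair_pmf_Times measure_Pi_pmf_Pi man del: prod_dividef)
qed

lemma random_profile_permutes:
  assumes "pf \<in> set_pmf (random_profile n1 n2)"
  shows "m \<in> {1..n1} \<Longrightarrow> fst pf m permutes {1..n2}"
    and "w \<in> {1..n2} \<Longrightarrow> snd pf w permutes {1..n1}"
proof -
  have "set_pmf (random_ranking n) = {p. p permutes {1..n}}" for n
    unfolding random_ranking_def
    by (rule set_pmf_of_set) (auto intro: finite_permutations permutes_id)
  then show "m \<in> {1..n1} \<Longrightarrow> fst pf m permutes {1..n2}"
    and "w \<in> {1..n2} \<Longrightarrow> snd pf w permutes {1..n1}"
    using assms by (auto simp: random_profile_def set_Pi_pmf PiE_dflt_def)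
qed

text \<open>A partner's position is one more than the number of people above him or her, and summing
  over the \<open>n1\<close> couples produces the offset \<open>n1\<close>. The rows of the man
  pattern see only matched women, hence the hypothesis in the first claim.\<close>

lemma ranks_eq_card_patterns:
  assumes M: "matching n1 n2 \<M>" and pf: "pf \<in> set_pmf (random_profile n1 n2)"
  shows "prefers_no_single n1 n2 \<M> pf \<Longrightarrow>
      rank_wives n1 pf \<M> = n1 + card (man_pattern n1 \<M> pf)"
    and "rank_husbands n1 pf \<M> = n1 + card (woman_pattern n1 \<M> pf)"
proof -
  let ?A = "man_pattern n1 \<M> pf" and ?B = "woman_pattern n1 \<M> pf"
  have inj: "inj_on \<M> {1..n1}" and rng: "\<And>i. i \<in> {1..n1} \<Longrightarrow> \<M> i \<in> {1..n2}"
    using M unfolding matching_def by blast+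
  have A: "?A \<subseteq> off_diag n1" and B: "?B \<subseteq> off_diag n1"
    by (auto simp: man_pattern_def woman_pattern_def)
  have card: "card C = (\<Sum>i\<in>{1..n1}. card (C `` {i}))" if "C \<subseteq> off_diag n1" for C
    by (rule card_eq_sum_Image)
      (use that finite_subset[OF that finite_off_diag] in \<open>auto simp: off_diag_def\<close>)
  show "rank_wives n1 pf \<M> = n1 + card ?A" if ns: "prefers_no_single n1 n2 \<M> pf"
  proof -
    have "fst pf i (\<M> i) = 1 + card (?A `` {i})" if i: "i \<in> {1..n1}" for i
    proof -
      have "card (preferred n2 (fst pf i) (\<M> i)) = card (\<M> ` (?A `` {i}))"
        using ns i man_pattern_Image[OF M i, of pf]
        by (simp add: prefers_no_single_def Int_absorb2)
      also have "\<dots> = card (?A `` {i})"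
        by (rule card_image, rule inj_on_subset[OF inj]) (use A in \<open>auto simp: off_diag_def\<close>)
      finally show ?thesis
        using position_eq_card_preferred[OF random_profile_permutes(1)[OF pf i] rng[OF i]] by simp
    qed
    then have "rank_wives n1 pf \<M> = (\<Sum>i\<in>{1..n1}. 1 + card (?A `` {i}))"
      unfolding rank_wives_def by (intro sum.cong) auto
    then show ?thesis using card[OF A] by (simp add: sum_Suc)
  qed
  have "snd pf (\<M> j) j = 1 + card (?B\<inverse> `` {j})" if j: "j \<in> {1..n1}" for j
    using position_eq_card_preferred[OF random_profile_permutes(2)[OF pf rng[OF j]] j]
    by (simp add: woman_pattern_Image[OF j])
  then have "rank_husbands n1 pf \<M> = (\<Sum>j\<in>{1..n1}. 1 + card (?B\<inverse> `` {j}))"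
    unfolding rank_husbands_def sum.reindex[OF inj] by (simp add: husband_matching[OF M])
  moreover have "card (?B\<inverse>) = (\<Sum>j\<in>{1..n1}. card (?B\<inverse> `` {j}))"
    by (rule card) (use B in \<open>auto simp: off_diag_def\<close>)
  ultimately show "rank_husbands n1 pf \<M> = n1 + card ?B"
    by (simp add: sum_Suc)
qed

section \<open>Summation over the disjoint patterns\<close>

text \<open>The predicate \<open>\<Phi>\<close> on the two total ranks treats all four probabilities
  at once. The event splits into finitely many disjoint pattern events, whose probabilities are the
  cube integrals of the weights.\<close>

lemma prob_stable_ranks:
  assumes n: "n1 < n2" and M: "matching n1 n2 \<M>"
  shows "measure_pmf.prob (random_profile n1 n2)
      {pf. stable n1 n2 pf \<M> \<and> \<Phi> (rank_wives n1 pf \<M>) (rank_husbands n1 pf \<M>)}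
    = cube_integral n1 (\<lambda>x y.
        (\<Sum>(A, B)\<in>{(A, B) \<in> disjoint_patterns n1. \<Phi> (n1 + card A) (n1 + card B)}.
           pattern_weight n1 x y A B) * (\<Prod>h\<in>{1..n1}. (1 - x h) ^ (n2 - n1)))"
    (is "?P = _")
proof -
  let ?D = "{p \<in> disjoint_patterns n1. \<Phi> (n1 + card (fst p)) (n1 + card (snd p))}"
  let ?E = "\<lambda>p. {pf. prefers_no_single n1 n2 \<M> pf \<and> man_pattern n1 \<M> pf = fst p
      \<and> woman_pattern n1 \<M> pf = snd p}"
  let ?K = "\<lambda>p x y. pattern_weight n1 x y (fst p) (snd p) * (\<Prod>h\<in>{1..n1}. (1 - x h) ^ (n2 - n1))"
  have finD: "finite ?D" using finite_disjoint_patterns by simp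
  have D: "fst p \<subseteq> off_diag n1" "snd p \<subseteq> off_diag n1" if "p \<in> ?D" for p
    using that by (auto simp: disjoint_patterns_def)
  have "?P = measure_pmf.prob (random_profile n1 n2) (\<Union>p\<in>?D. ?E p)"
  \<comment> \<open>The two events are compared only on the support, where the rankings are
    permutations and the rank formulas hold.\<close>
  proof (rule measure_pmf.finite_measure_eq_AE)
    show "AE pf in random_profile n1 n2.
        (pf \<in> {pf. stable n1 n2 pf \<M> \<and> \<Phi> (rank_wives n1 pf \<M>) (rank_husbands n1 pf \<M>)})
        = (pf \<in> (\<Union>p\<in>?D. ?E p))"
      unfolding AE_measure_pmf_iff
    proof
      fix pf assume pf: "pf \<in> set_pmf (random_profile n1 n2)"
      have "(man_pattern n1 \<M> pf, woman_pattern n1 \<M> pf) \<in> disjoint_patterns n1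
          \<longleftrightarrow> man_pattern n1 \<M> pf \<inter> woman_pattern n1 \<M> pf = {}"
        by (auto simp: disjoint_patterns_def man_pattern_def woman_pattern_def)
      then show "(pf \<in> {pf. stable n1 n2 pf \<M> \<and> \<Phi> (rank_wives n1 pf \<M>) (rank_husbands n1 pf \<M>)})
        = (pf \<in> (\<Union>p\<in>?D. ?E p))"
        using ranks_eq_card_patterns[OF M pf] by (auto simp: stable_iff_patterns[OF M])
    qed
  qed auto
  also have "\<dots> = (\<Sum>p\<in>?D. measure_pmf.prob (random_profile n1 n2) (?E p))"
    by (rule measure_pmf.finite_measure_finite_Union[OF finD])
      (auto simp: disjoint_family_on_def prod_eq_iff)
  also have "\<dots> = (\<Sum>p\<in>?D. cube_integral n1 (?K p))"
    using prob_patterns[OF M D] cube_integral_pattern_weight(2)[OF n D]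
    by (intro sum.cong refl) simp
  also have "\<dots> = cube_integral n1 (\<lambda>x y. \<Sum>p\<in>?D. ?K p x y)"
    by (rule cube_integral_sum[symmetric]) (rule cube_integral_pattern_weight(1)[OF n D])
  finally show ?thesis
    by (simp add: sum_distrib_right case_prod_beta')
qed

theorem lemma1p2:
  fixes n1 n2 :: nat and \<M> :: "nat \<Rightarrow> nat" and k l :: nat
  assumes "0 < n1" and "n1 < n2" and "matching n1 n2 \<M>"
  shows "prob_stable n1 n2 \<M> =
           cube_integral n1 (\<lambda>x y.
             (\<Prod>(i, j)\<in>off_diag n1. 1 - x i * y j)
             * (\<Prod>h\<in>{1..n1}. (1 - x h) ^ (n2 - n1)))
       \<and> prob_stable_Q n1 n2 \<M> k =
           cube_integral n1 (\<lambda>x y.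
             icoeff (\<Prod>(i, j)\<in>off_diag n1. 1 - [:x i:] * (1 - indet + indet * [:y j:]))
                    (int k - int n1)
             * (\<Prod>h\<in>{1..n1}. (1 - x h) ^ (n2 - n1)))
       \<and> prob_stable_R n1 n2 \<M> l =
           cube_integral n1 (\<lambda>x y.
             icoeff (\<Prod>(i, j)\<in>off_diag n1. 1 - [:y j:] * (1 - indet + indet * [:x i:]))
                    (int l - int n1)
             * (\<Prod>h\<in>{1..n1}. (1 - x h) ^ (n2 - n1)))
       \<and> prob_stable_QR n1 n2 \<M> k l =
           cube_integral n1 (\<lambda>x y.
             icoeff2 (\<Prod>(i, j)\<in>off_diag n1.
                         const2 ((1 - x i) * (1 - y j))
                         + const2 (x i * (1 - y j)) * xi2
                         + const2 ((1 - x i) * y j) * eta2)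
                     (int k - int n1) (int l - int n1)
             * (\<Prod>h\<in>{1..n1}. (1 - x h) ^ (n2 - n1)))"
  unfolding prod_off_diag_eq_sum icoeff_prod_xi_eq_sum icoeff_prod_eta_eq_sum icoeff2_prod_eq_sum
    prob_stable_def prob_stable_Q_def prob_stable_R_def prob_stable_QR_def
  \<comment> \<open>The four predicates select all disjoint patterns, those with
    \<open>n1 + card A = k\<close>, those with \<open>n1 + card B = l\<close>, and those with both,
    matching the four expanded integrands.\<close>
  using prob_stable_ranks[OF assms(2,3), of "\<lambda>_ _. True"]
    prob_stable_ranks[OF assms(2,3), of "\<lambda>q _. q = k"]
    prob_stable_ranks[OF assms(2,3), of "\<lambda>_ r. r = l"]
    prob_stable_ranks[OF assms(2,3), of "\<lambda>q r. q = k \<and> r = l"]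
  by simp

end
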